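(* Let $(K,|\cdot|)$ be a field with an absolute value, $X$ a set, $\mathscr{F}(X)\subseteq K^X$ a $K$-vector space of functions, $\Omega\subseteq\mathscr{F}(X)$ a subgroup of the additive group $(\mathscr{F}(X),+)$, and $\mathbf{Q}=\{x_1,\ldots,x_L\}\subseteq X$ a finite set. For $1\le p\le\infty$ let $\|f\|_p^{(\mathbf{Q})}:=\big(\sum_{i=1}^L|f(x_i)|^p\big)^{1/p}$ (and $\|f\|_\infty^{(\mathbf{Q})}:=\max_{1\le i\le L}|f(x_i)|$). The following are equivalent: (i) $\mathbf{Q}$ is a correct test sequence for $\Omega$. (ii) $\mathbf{Q}$ is a finite norming set for $\Omega$. (iii) The restriction to $\Omega$ of the evaluation map $\mathrm{ev}_{\mathbf{Q}}:f\mapsto(f(x_1),\ldots,f(x_L))\in K^L$ is a group monomorphism. (iv) There exists $p$, $1\le p\le\infty$, such that $\|\cdot\|_p^{(\mathbf{Q})}$ is a norm on $\Omega$. (v) For every $p$, $1\le p\le\infty$, $\|\cdot\|_p^{(\mathbf{Q})}$ is a norm on $\Omega$. (vi) $\Omega$ is a metric space with the distance function $d_\infty^{(\mathbf{Q})}(f,g):=\|f-g\|_\infty^{(\mathbf{Q})}$. (vii) For every $p$, $1\le p\le\infty$, $\Omega$ is a metric space with the distance function $d_p^{(\mathbf{Q})}(f,g):=\|f-g\|_p^{(\mathbf{Q})}$. In particular, $\Omega$ has a finite length correct test sequence if and only if it admits a finite norming set. If, additionally, $\Omega$ is a linear subspace of $\mathscr{F}(X)$, then $\Omega$ admits a correct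 test sequence of finite length if and only if $\Omega$ is a normed linear space of finite dimension.
   Context: A finite set $\mathbf{Q}=\{x_1,\ldots,x_L\}\subseteq X$ is a correct test sequence for $\Omega$ (with respect to $\{0\}$) if for every $f\in\Omega$: $f(x_1)=\cdots=f(x_L)=0$ implies $f=0$. A "norm" on a subset $\Omega$ (not necessarily a subspace) is a function $\|\cdot\|:\Omega\to\mathbb{R}_+$ such that: $\|f\|\ge0$; for $f\in\Omega$, $\|f\|=0$ iff $f=0$; $\|f+g\|\le\|f\|+\|g\|$ whenever $f,g,f+g\in\Omega$; $\|\lambda f\|\le|\lambda|\,\|f\|$ whenever $f\in\Omega$, $\lambda\in K$ and $\lambda f\in\Omega$. $\mathbf{Q}$ is a finite norming set for $\Omega$ if $\|f\|_\infty^{(\mathbf{Q})}=\max\{|f(x_i)|:1\le i\le L\}$ is a norm on $\Omega$ in this sense. *)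

theory Defs
  imports
    "HOL-Analysis.Analysis"
    "HOL-Algebra.Product_Groups"
    "HOL-Library.Function_Algebras"
begin

definition absolute_value :: "('k::field \<Rightarrow> real) \<Rightarrow> bool" where
  "absolute_value av \<longleftrightarrow>
     (\<forall>a. 0 \<le> av a) \<and> (\<forall>a. av a = 0 \<longleftrightarrow> a = 0) \<and>
     (\<forall>a b. av (a * b) = av a * av b) \<and> (\<forall>a b. av (a + b) \<le> av a + av b)"

text \<open>
  The space \<open>K\<^sup>X\<close> is represented by the functions that are \<open>0\<close> off \<open>X\<close>, so that the pointwise
  operations and the zero of the function type are those of \<open>K\<^sup>X\<close>, and \<open>X\<close> may be empty.
\<close>
definition functions_on :: "'x set \<Rightarrow> ('x \<Rightarrow> 'k::zero) set" where
  "functions_on X = {f. \<forall>x. x \<notin> X \<longrightarrow> f x = 0}"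

definition fscale :: "'k::times \<Rightarrow> ('x \<Rightarrow> 'k) \<Rightarrow> 'x \<Rightarrow> 'k" where
  "fscale c f = (\<lambda>x. c * f x)"

lemma vector_space_fscale:
  "vector_space (fscale :: 'k::field \<Rightarrow> ('x \<Rightarrow> 'k) \<Rightarrow> 'x \<Rightarrow> 'k)"
  by unfold_locales (auto simp: fscale_def fun_eq_iff algebra_simps)

definition finite_dimensional :: "('x \<Rightarrow> 'k::field) set \<Rightarrow> bool" where
  "finite_dimensional V \<longleftrightarrow> (\<exists>B. finite B \<and> B \<subseteq> V \<and> Modules.module.span fscale B = V)"

definition additive_group :: "'a::ab_group_add set \<Rightarrow> 'a monoid" where
  "additive_group A = \<lparr>carrier = A, monoid.mult = (+), one = 0\<rparr>"

definition correct_test_sequence ::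
    "'x set \<Rightarrow> ('x \<Rightarrow> 'k::field) set \<Rightarrow> 'x set \<Rightarrow> bool" where
  "correct_test_sequence X \<Omega> Q \<longleftrightarrow>
     finite Q \<and> Q \<subseteq> X \<and> (\<forall>f\<in>\<Omega>. (\<forall>q\<in>Q. f q = 0) \<longrightarrow> f = 0)"

text \<open>
  A norm on a subset that need not be a subspace; homogeneity is only required as an inequality,
  in contrast to \<open>normed_linear_space\<close> below.
\<close>
definition norm_on_subset ::
    "('k::field \<Rightarrow> real) \<Rightarrow> ('x \<Rightarrow> 'k) set \<Rightarrow> (('x \<Rightarrow> 'k) \<Rightarrow> real) \<Rightarrow> bool" where
  "norm_on_subset av \<Omega> N \<longleftrightarrow>
     (\<forall>f\<in>\<Omega>. 0 \<le> N f) \<and>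
     (\<forall>f\<in>\<Omega>. N f = 0 \<longleftrightarrow> f = 0) \<and>
     (\<forall>f g. f \<in> \<Omega> \<longrightarrow> g \<in> \<Omega> \<longrightarrow> f + g \<in> \<Omega> \<longrightarrow> N (f + g) \<le> N f + N g) \<and>
     (\<forall>c f. f \<in> \<Omega> \<longrightarrow> fscale c f \<in> \<Omega> \<longrightarrow> N (fscale c f) \<le> av c * N f)"

definition normed_linear_space ::
    "('k::field \<Rightarrow> real) \<Rightarrow> ('x \<Rightarrow> 'k) set \<Rightarrow> (('x \<Rightarrow> 'k) \<Rightarrow> real) \<Rightarrow> bool" where
  "normed_linear_space av V N \<longleftrightarrow>
     Modules.module.subspace fscale V \<and>
     (\<forall>f\<in>V. 0 \<le> N f) \<and>
     (\<forall>f\<in>V. N f = 0 \<longleftrightarrow> f = 0) \<and>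
     (\<forall>f\<in>V. \<forall>g\<in>V. N (f + g) \<le> N f + N g) \<and>
     (\<forall>c. \<forall>f\<in>V. N (fscale c f) = av c * N f)"

text \<open>The maximum over the empty set of points is read as \<open>0\<close>.\<close>
definition sup_norm :: "('k \<Rightarrow> real) \<Rightarrow> 'x set \<Rightarrow> ('x \<Rightarrow> 'k) \<Rightarrow> real" where
  "sup_norm av Q f = (if Q = {} then 0 else Max ((\<lambda>q. av (f q)) ` Q))"

definition p_norm ::
    "('k \<Rightarrow> real) \<Rightarrow> nat \<Rightarrow> (nat \<Rightarrow> 'x) \<Rightarrow> ereal \<Rightarrow> ('x \<Rightarrow> 'k) \<Rightarrow> real" where
  "p_norm av L x p f =
     (if p = \<infinity> then sup_norm av (x ` {1..L}) f
      else (\<Sum>i=1..L. av (f (x i)) powr real_of_ereal p) powr (1 / real_of_ereal p))"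

definition finite_norming_set ::
    "('k::field \<Rightarrow> real) \<Rightarrow> 'x set \<Rightarrow> ('x \<Rightarrow> 'k) set \<Rightarrow> 'x set \<Rightarrow> bool" where
  "finite_norming_set av X \<Omega> Q \<longleftrightarrow>
     finite Q \<and> Q \<subseteq> X \<and> norm_on_subset av \<Omega> (sup_norm av Q)"

definition ev :: "nat \<Rightarrow> (nat \<Rightarrow> 'x) \<Rightarrow> ('x \<Rightarrow> 'k) \<Rightarrow> nat \<Rightarrow> 'k" where
  "ev L x f = (\<lambda>i\<in>{1..L}. f (x i))"

end

theory Submission
  imports Defs
begin

text \<open>
  Every condition says that the only member of \<open>\<Omega>\<close> that vanishes on \<open>Q\<close> is \<open>0\<close>; those that compare
  two functions reduce to this because \<open>\<Omega>\<close> is closed under differences. For the evaluation map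
  this is triviality of the kernel. Each \<open>p\<close>-norm is defined on all of \<open>K\<^sup>X\<close>, where it is a
  seminorm whose null space consists of the functions vanishing on \<open>Q\<close>; so the only axiom of a
  norm on \<open>\<Omega>\<close>, or of a metric on \<open>\<Omega>\<close>, that can fail is definiteness, and it holds exactly if
  \<open>Q\<close> is a correct test sequence. The locale \<open>evaluation_seminorm\<close> carries out this argument
  once for all \<open>p\<close>; verifying its axioms for finite \<open>p\<close> rests on Minkowski's inequality.

  For a linear subspace, linear algebra shows that a finite correct test sequence exists exactly in
  finite dimension. Imposing \<open>f q = 0\<close> for one point \<open>q\<close> at a time lowers the dimension by at most
  one, so a space tested by finitely many points has a finite spanning set
  (\<open>finite_dimensional_if_tested_finitely\<close>). Conversely, adding one vector to a spanning
  set adds at most a line of functions that vanish on the points chosen so far, and one more point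
  detects this line (\<open>span_finite_has_test_points\<close>). The norm belonging to a finite correct test
  sequence is the maximum over its points, which is homogeneous with equality because nonzero
  scalars can be inverted.
\<close>

section \<open>Absolute values and additive subgroups\<close>

context
  fixes av :: "'k::field \<Rightarrow> real"
  assumes av: "absolute_value av"
begin

lemma av_nonneg: "0 \<le> av a"
  and av_eq_0_iff: "av a = 0 \<longleftrightarrow> a = 0"
  and av_mult: "av (a * b) = av a * av b"
  and av_triangle: "av (a + b) \<le> av a + av b"
  using av by (auto simp: absolute_value_def)

lemma av_1: "av 1 = 1"
  using av_mult[of 1 1] av_eq_0_iff[of 1] by simp

lemma av_minus_1: "av (- 1) = 1"
proof -
  have "(av (- 1))\<^sup>2 = 1"
    using av_mult[of "- 1" "- 1"] by (simp add: av_1 power2_eq_square)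
  then show ?thesis
    using av_nonneg[of "- 1"] by (auto simp: power2_eq_1_iff)
qed

lemma av_mult_inverse:
  assumes "c \<noteq> 0" shows "av c * av (inverse c) = 1"
  using assms by (simp add: av_1 flip: av_mult)

end

interpretation fun_space: vector_space "fscale :: 'k::field \<Rightarrow> ('x \<Rightarrow> 'k) \<Rightarrow> 'x \<Rightarrow> 'k"
  by (rule vector_space_fscale)

text \<open>
  The inverse in the monoid \<open>additive_group F\<close> agrees with \<open>-\<close> because \<open>F\<close> itself is closed under
  negation.
\<close>
lemma subgroup_additive_group_closed:
  fixes \<Omega> F :: "('x \<Rightarrow> 'k::field) set"
  assumes F: "Modules.module.subspace fscale F" and sub: "subgroup \<Omega> (additive_group F)"
  shows "0 \<in> \<Omega>" and "\<And>f g. f \<in> \<Omega> \<Longrightarrow> g \<in> \<Omega> \<Longrightarrow> f - g \<in> \<Omega>"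
proof -
  show "0 \<in> \<Omega>"
    using subgroup.one_closed[OF sub] by (simp add: additive_group_def)
  fix f g assume f: "f \<in> \<Omega>" and g: "g \<in> \<Omega>"
  have gF: "g \<in> F"
    using subgroup.subset[OF sub] g by (auto simp: additive_group_def)
  have "inv\<^bsub>additive_group F\<^esub> g = - g"
    unfolding m_inv_def
    by (rule the_equality)
      (auto simp: additive_group_def gF fun_space.subspace_neg[OF F] minus_unique)
  then have "- g \<in> \<Omega>"
    using subgroup.m_inv_closed[OF sub g] by simp
  then show "f - g \<in> \<Omega>"
    using subgroup.m_closed[OF sub f, of "- g"] by (simp add: additive_group_def)
qed

lemma correct_test_sequence_iff_ev_mon:
  fixes \<Omega> :: "('x \<Rightarrow> 'k::field) set"
  assumes zero: "0 \<in> \<Omega>" and diff: "\<And>f g. f \<in> \<Omega> \<Longrightarrow> g \<in> \<Omega> \<Longrightarrow> f - g \<in> \<Omega>"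
    and X: "x ` {1..L} \<subseteq> X"
  shows "correct_test_sequence X \<Omega> (x ` {1..L}) \<longleftrightarrow>
    ev L x \<in> mon (additive_group \<Omega>)
      (product_group {1..L} (\<lambda>_. additive_group (UNIV :: 'k set)))"
proof -
  have hom: "ev L x \<in> hom (additive_group \<Omega>)
      (product_group {1..L} (\<lambda>_. additive_group (UNIV :: 'k set)))"
    by (auto simp: hom_def additive_group_def ev_def fun_eq_iff restrict_def)
  have ev_eq: "ev L x f = ev L x g \<longleftrightarrow> (\<forall>q\<in>x ` {1..L}. (f - g) q = 0)" for f g :: "'x \<Rightarrow> 'k"
    by (auto simp: ev_def fun_eq_iff restrict_def)
  have "inj_on (ev L x) \<Omega> \<longleftrightarrow> (\<forall>f\<in>\<Omega>. (\<forall>q\<in>x ` {1..L}. f q = 0) \<longrightarrow> f = 0)"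
  proof
    assume inj: "inj_on (ev L x) \<Omega>"
    show "\<forall>f\<in>\<Omega>. (\<forall>q\<in>x ` {1..L}. f q = 0) \<longrightarrow> f = 0"
      using inj_onD[OF inj _ _ zero] by (simp add: ev_eq)
  next
    assume ct: "\<forall>f\<in>\<Omega>. (\<forall>q\<in>x ` {1..L}. f q = 0) \<longrightarrow> f = 0"
    show "inj_on (ev L x) \<Omega>"
    proof (rule inj_onI)
      fix f g assume "f \<in> \<Omega>" "g \<in> \<Omega>" "ev L x f = ev L x g"
      then have "f - g = 0"
        using ct diff unfolding ev_eq by blast
      then show "f = g" by simp
    qed
  qed
  then show ?thesis
    using hom X by (simp add: mon_def correct_test_sequence_def additive_group_def)
qed

section \<open>Seminorms determined by values at finitely many points\<close>

text \<open>
  Homogeneity is assumed as an inequality only; over a field the reverse inequality follows by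
  applying it to the inverse scalar.
\<close>
locale evaluation_seminorm =
  fixes av :: "'k::field \<Rightarrow> real" and Q :: "'x set" and N :: "('x \<Rightarrow> 'k) \<Rightarrow> real"
  assumes av: "absolute_value av"
    and nonneg: "0 \<le> N f"
    and eq_0_iff: "N f = 0 \<longleftrightarrow> (\<forall>q\<in>Q. f q = 0)"
    and triangle: "N (f + g) \<le> N f + N g"
    and fscale_le: "N (fscale c f) \<le> av c * N f"
begin

lemma fscale_eq: "N (fscale c f) = av c * N f"
proof (cases "c = 0")
  case True
  then have "N (fscale c f) = 0" by (simp add: eq_0_iff fscale_def)
  then show ?thesis using True av_eq_0_iff[OF av, of 0] by simp
next
  case False
  have "av c * N f = av c * N (fscale (inverse c) (fscale c f))"
    using False by simp
  also have "\<dots> \<le> av c * (av (inverse c) * N (fscale c f))"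
    by (intro mult_left_mono fscale_le av_nonneg[OF av])
  also have "\<dots> = N (fscale c f)"
    using av_mult_inverse[OF av False] by (simp add: mult.assoc[symmetric])
  finally show ?thesis using fscale_le[of c f] by simp
qed

lemma minus_commute: "N (f - g) = N (g - f)"
proof -
  have "f - g = fscale (- 1) (g - f)" by (simp add: fscale_def fun_eq_iff)
  then have "N (f - g) = N (fscale (- 1) (g - f))" by simp
  then show ?thesis by (simp only: fscale_eq av_minus_1[OF av] mult_1)
qed

lemma correct_test_sequence_iff_definite:
  assumes "finite Q" and "Q \<subseteq> X"
  shows "correct_test_sequence X \<Omega> Q \<longleftrightarrow> (\<forall>f\<in>\<Omega>. N f = 0 \<longrightarrow> f = 0)"
  using assms by (simp add: correct_test_sequence_def eq_0_iff)

lemma zero: "N 0 = 0"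
  by (simp add: eq_0_iff)

lemma correct_test_sequence_iff_norm_on_subset:
  assumes "finite Q" and "Q \<subseteq> X"
  shows "correct_test_sequence X \<Omega> Q \<longleftrightarrow> norm_on_subset av \<Omega> N"
  unfolding correct_test_sequence_iff_definite[OF assms] norm_on_subset_def
  using nonneg zero triangle fscale_le by blast

lemma correct_test_sequence_iff_Metric_space:
  assumes Q: "finite Q" "Q \<subseteq> X"
    and 0: "0 \<in> \<Omega>" and diff: "\<And>f g. f \<in> \<Omega> \<Longrightarrow> g \<in> \<Omega> \<Longrightarrow> f - g \<in> \<Omega>"
  shows "correct_test_sequence X \<Omega> Q \<longleftrightarrow> Metric_space \<Omega> (\<lambda>f g. N (f - g))"
  unfolding correct_test_sequence_iff_definite[OF Q]
proof
  assume def: "\<forall>f\<in>\<Omega>. N f = 0 \<longrightarrow> f = 0"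
  show "Metric_space \<Omega> (\<lambda>f g. N (f - g))"
  proof
    fix f g h
    show "0 \<le> N (f - g)" by (rule nonneg)
    show "N (f - g) = N (g - f)" by (rule minus_commute)
    show "N (f - g) = 0 \<longleftrightarrow> f = g" if "f \<in> \<Omega>" "g \<in> \<Omega>"
      using def diff[OF that] zero by auto
    show "N (f - h) \<le> N (f - g) + N (g - h)"
      using triangle[of "f - g" "g - h"] by simp
  qed
next
  assume "Metric_space \<Omega> (\<lambda>f g. N (f - g))"
  then show "\<forall>f\<in>\<Omega>. N f = 0 \<longrightarrow> f = 0"
    using Metric_space.zero[of \<Omega> "\<lambda>f g. N (f - g)" _ 0] 0 by simp
qed

lemma normed_linear_space_if_correct_test_sequence:
  assumes "Modules.module.subspace fscale V" and "correct_test_sequence X V Q"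
  shows "normed_linear_space av V N"
  using assms nonneg triangle fscale_eq zero
  by (auto simp: normed_linear_space_def correct_test_sequence_def eq_0_iff)

end

section \<open>The maximum norm\<close>

lemma sup_norm_upper:
  assumes "finite Q" "q \<in> Q" shows "av (f q) \<le> sup_norm av Q f"
  using assms by (auto simp: sup_norm_def)

lemma sup_norm_least:
  assumes "finite Q" "0 \<le> c" "\<And>q. q \<in> Q \<Longrightarrow> av (f q) \<le> c" shows "sup_norm av Q f \<le> c"
  using assms by (auto simp: sup_norm_def)

lemma evaluation_seminorm_sup_norm:
  assumes av: "absolute_value av" and Q: "finite Q"
  shows "evaluation_seminorm av Q (sup_norm av Q)"
proof
  note upper = sup_norm_upper[OF Q, where av = av]
  show nonneg: "0 \<le> sup_norm av Q f" for f
    using Q av_nonneg[OF av] by (cases "Q = {}") (auto simp: sup_norm_def Max_ge_iff)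
  show "sup_norm av Q f = 0 \<longleftrightarrow> (\<forall>q\<in>Q. f q = 0)" for f
  proof
    assume "sup_norm av Q f = 0"
    then show "\<forall>q\<in>Q. f q = 0"
      using upper[of _ f] av_nonneg[OF av] av_eq_0_iff[OF av] by (metis order_antisym)
  next
    assume "\<forall>q\<in>Q. f q = 0"
    then have "sup_norm av Q f \<le> 0"
      using av_eq_0_iff[OF av, of 0] by (intro sup_norm_least[OF Q]) auto
    then show "sup_norm av Q f = 0" using nonneg[of f] by simp
  qed
  show "sup_norm av Q (f + g) \<le> sup_norm av Q f + sup_norm av Q g" for f g
  proof (rule sup_norm_least[OF Q])
    show "av ((f + g) q) \<le> sup_norm av Q f + sup_norm av Q g" if "q \<in> Q" for q
      using av_triangle[OF av, of "f q" "g q"] upper[OF that, of f] upper[OF that, of g] by simp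
  qed (simp add: nonneg)
  show "sup_norm av Q (fscale c f) \<le> av c * sup_norm av Q f" for c f
  proof (rule sup_norm_least[OF Q])
    show "av (fscale c f q) \<le> av c * sup_norm av Q f" if "q \<in> Q" for q
      using upper[OF that, of f] av_nonneg[OF av, of c]
      by (simp add: fscale_def av_mult[OF av] mult_left_mono)
  qed (simp add: nonneg av_nonneg[OF av])
qed (rule av)

section \<open>Minkowski's inequality and the p-norms\<close>

text \<open>
  Convexity of \<open>t powr p\<close> on the open half-line extends to the endpoint \<open>0\<close>, where it says that
  \<open>u powr p \<le> u\<close> for \<open>0 \<le> u \<le> 1\<close>.
\<close>
lemma powr_convex_combination_le:
  fixes s t u v p :: real
  assumes p: "1 \<le> p" and st: "0 \<le> s" "0 \<le> t" and uv: "0 < u" "0 < v" "u + v = 1"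
  shows "(u * s + v * t) powr p \<le> u * s powr p + v * t powr p"
proof -
  have scaled: "(w * r) powr p \<le> w * r powr p" if "0 < w" "w \<le> 1" "0 \<le> r" for w r :: real
    using powr_mono'[OF p, of w] that by (simp add: powr_mult mult_right_mono)
  show ?thesis
  proof (cases "s = 0 \<or> t = 0")
    case True
    then show ?thesis using scaled[of v t] scaled[of u s] st uv by auto
  next
    case False
    have u: "u = 1 - v" using uv by simp
    show ?thesis
      unfolding u using convex_onD[OF powr_convex[OF p], of v s t] False st uv by simp
  qed
qed

text \<open>
  After normalising both vectors to \<open>p\<close>-norm \<open>1\<close>, their weighted mean with weights proportional to
  the original norms is controlled by convexity in each coordinate.
\<close>
lemma Minkowski_sum_powr:
  fixes a b :: "'i \<Rightarrow> real"
  assumes I: "finite I" and p: "1 \<le> p"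
    and a: "\<And>i. i \<in> I \<Longrightarrow> 0 \<le> a i" and b: "\<And>i. i \<in> I \<Longrightarrow> 0 \<le> b i"
  shows "(\<Sum>i\<in>I. (a i + b i) powr p) powr (1 / p) \<le>
    (\<Sum>i\<in>I. a i powr p) powr (1 / p) + (\<Sum>i\<in>I. b i powr p) powr (1 / p)"
proof -
  define A where "A = (\<Sum>i\<in>I. a i powr p) powr (1 / p)"
  define B where "B = (\<Sum>i\<in>I. b i powr p) powr (1 / p)"
  show ?thesis
  proof (cases "A = 0 \<or> B = 0")
    case True
    then have "(\<forall>i\<in>I. a i = 0) \<or> (\<forall>i\<in>I. b i = 0)"
      by (auto simp: A_def B_def sum_nonneg_eq_0_iff I)
    then show ?thesis by auto
  next
    case False
    then have pos: "0 < A" "0 < B" by (auto simp: A_def B_def less_le)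
    have Ap: "A powr p = (\<Sum>i\<in>I. a i powr p)" and Bp: "B powr p = (\<Sum>i\<in>I. b i powr p)"
      using p by (auto simp: A_def B_def powr_powr sum_nonneg)
    define u where "u = A / (A + B)"
    define v where "v = B / (A + B)"
    have uv: "0 < u" "0 < v" "u + v = 1"
      using pos by (auto simp: u_def v_def add_divide_distrib[symmetric])
    have "(a i + b i) powr p \<le>
        (A + B) powr p * (u * (a i powr p / A powr p) + v * (b i powr p / B powr p))" if "i \<in> I" for i
    proof -
      have "u * (a i / A) + v * (b i / B) = (a i + b i) / (A + B)"
        using pos by (simp add: u_def v_def add_divide_distrib)
      then have "a i + b i = (A + B) * (u * (a i / A) + v * (b i / B))"
        using pos by simp
      then have "(a i + b i) powr p = ((A + B) * (u * (a i / A) + v * (b i / B))) powr p"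
        by (rule arg_cong)
      also have "\<dots> = (A + B) powr p * (u * (a i / A) + v * (b i / B)) powr p"
        by (rule powr_mult)
      also have "\<dots> \<le> (A + B) powr p * (u * (a i / A) powr p + v * (b i / B) powr p)"
        using a[OF that] b[OF that] pos uv
        by (intro mult_left_mono powr_convex_combination_le[OF p]) auto
      finally show ?thesis
        using a[OF that] b[OF that] pos by (simp add: powr_divide)
    qed
    then have "(\<Sum>i\<in>I. (a i + b i) powr p) \<le>
        (\<Sum>i\<in>I. (A + B) powr p * (u * (a i powr p / A powr p) + v * (b i powr p / B powr p)))"
      by (rule sum_mono)
    also have "\<dots> = (A + B) powr p * (u * ((\<Sum>i\<in>I. a i powr p) / A powr p)
        + v * ((\<Sum>i\<in>I. b i powr p) / B powr p))"
      by (simp add: sum_distrib_left[symmetric] sum.distrib sum_divide_distrib[symmetric])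
    also have "\<dots> = (A + B) powr p"
      using pos uv by (simp flip: Ap Bp)
    finally have "(\<Sum>i\<in>I. (a i + b i) powr p) powr (1 / p) \<le> ((A + B) powr p) powr (1 / p)"
      using p by (intro powr_mono2) (auto intro: sum_nonneg)
    also have "\<dots> = A + B"
      using p pos by (simp add: powr_powr)
    finally show ?thesis by (simp add: A_def B_def)
  qed
qed

lemma evaluation_seminorm_p_norm:
  fixes av :: "'k::field \<Rightarrow> real" and x :: "nat \<Rightarrow> 'x"
  assumes av: "absolute_value av" and p: "1 \<le> p"
  shows "evaluation_seminorm av (x ` {1..L}) (p_norm av L x p)"
proof (cases "p = \<infinity>")
  case True
  then have "p_norm av L x p = sup_norm av (x ` {1..L})"
    by (simp add: p_norm_def fun_eq_iff)
  then show ?thesis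
    using evaluation_seminorm_sup_norm[OF av, of "x ` {1..L}"] by simp
next
  case False
  define r where "r = real_of_ereal p"
  have r: "1 \<le> r"
    using p False by (cases p) (auto simp: r_def)
  have N: "p_norm av L x p f = (\<Sum>i=1..L. av (f (x i)) powr r) powr (1 / r)" for f
    using False by (simp add: p_norm_def r_def)
  show ?thesis
  proof
    fix f g :: "'x \<Rightarrow> 'k" and c
    show "0 \<le> p_norm av L x p f" by (simp add: N)
    show "p_norm av L x p f = 0 \<longleftrightarrow> (\<forall>q\<in>x ` {1..L}. f q = 0)"
      by (auto simp: N sum_nonneg_eq_0_iff av_eq_0_iff[OF av])
    have "(\<Sum>i=1..L. av ((f + g) (x i)) powr r) powr (1 / r)
        \<le> (\<Sum>i=1..L. (av (f (x i)) + av (g (x i))) powr r) powr (1 / r)"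
      using r av_triangle[OF av] av_nonneg[OF av]
      by (intro powr_mono2 sum_mono sum_nonneg) auto
    also have "\<dots> \<le> p_norm av L x p f + p_norm av L x p g"
      unfolding N by (intro Minkowski_sum_powr r av_nonneg[OF av]) auto
    finally show "p_norm av L x p (f + g) \<le> p_norm av L x p f + p_norm av L x p g"
      by (simp only: N)
    have "p_norm av L x p (fscale c f) = (av c powr r * (\<Sum>i=1..L. av (f (x i)) powr r)) powr (1 / r)"
      by (simp add: N fscale_def av_mult[OF av] powr_mult av_nonneg[OF av] sum_distrib_left)
    also have "\<dots> = av c * p_norm av L x p f"
      using r by (simp add: N powr_mult powr_powr sum_nonneg av_nonneg[OF av])
    finally show "p_norm av L x p (fscale c f) \<le> av c * p_norm av L x p f" by simp
  qed (rule av)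
qed

section \<open>Test points and finite dimension\<close>

text \<open>
  If the points \<open>Q\<close> chosen for \<open>span B\<close> miss some nonzero \<open>f\<close> in \<open>span (insert b B)\<close>, then every
  function of that span which vanishes on \<open>Q\<close> is a multiple of \<open>f\<close>: subtracting a suitable
  multiple of \<open>f\<close> removes its component along \<open>b\<close>. A point where \<open>f\<close> is nonzero thus completes \<open>Q\<close>.
\<close>
lemma span_finite_has_test_points:
  fixes B :: "('x \<Rightarrow> 'k::field) set"
  assumes "finite B"
  shows "\<exists>Q. finite Q \<and> (\<forall>f\<in>fun_space.span B. (\<forall>q\<in>Q. f q = 0) \<longrightarrow> f = 0)"
  using assms
proof (induction B)
  case empty
  then show ?case by auto
next
  case (insert b B)
  then obtain Q where Q: "finite Q"
    and test: "\<And>f. f \<in> fun_space.span B \<Longrightarrow> \<forall>q\<in>Q. f q = 0 \<Longrightarrow> f = 0"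
    by blast
  show ?case
  proof (cases "\<exists>f\<in>fun_space.span (insert b B). (\<forall>q\<in>Q. f q = 0) \<and> f \<noteq> 0")
    case False
    then show ?thesis using Q by blast
  next
    case True
    then obtain f where f: "f \<in> fun_space.span (insert b B)" "\<forall>q\<in>Q. f q = 0" "f \<noteq> 0"
      by blast
    obtain y where y: "f y \<noteq> 0"
      using f(3) by (auto simp: fun_eq_iff)
    obtain c where c: "f - fscale c b \<in> fun_space.span B"
      using f(1) by (auto simp: fun_space.span_breakdown_eq)
    have "c \<noteq> 0"
      using test[of f] c f(2,3) by (metis fun_space.scale_zero_left diff_zero)
    have "g = 0" if g: "g \<in> fun_space.span (insert b B)" "\<forall>q\<in>insert y Q. g q = 0" for g
    proof -
      obtain d where d: "g - fscale d b \<in> fun_space.span B"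
        using g(1) by (auto simp: fun_space.span_breakdown_eq)
      have "g - fscale (d / c) f = (g - fscale d b) - fscale (d / c) (f - fscale c b)"
        using \<open>c \<noteq> 0\<close> by (simp add: fscale_def fun_eq_iff field_simps)
      also have "\<dots> \<in> fun_space.span B"
        by (intro fun_space.span_diff fun_space.span_scale c d)
      finally have "g - fscale (d / c) f = 0"
        using f(2) g(2) by (intro test) (auto simp: fscale_def)
      then have eq: "g = fscale (d / c) f" by simp
      then have "g y = d / c * f y"
        by (simp only: fscale_def)
      then have "d / c * f y = 0"
        using g(2) by simp
      then have "d / c = 0" using y by simp
      then show "g = 0" using eq by simp
    qed
    moreover have "finite (insert y Q)" using Q by simp
    ultimately show ?thesis by blast
  qed
qed

lemma finite_dimensional_imp_correct_test_sequence:
  fixes V :: "('x \<Rightarrow> 'k::field) set"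
  assumes fd: "finite_dimensional V" and V: "V \<subseteq> functions_on X"
  shows "\<exists>Q. correct_test_sequence X V Q"
proof -
  obtain B where "finite B" "fun_space.span B = V"
    using fd by (auto simp: finite_dimensional_def)
  then obtain Q where Q: "finite Q" "\<And>f. f \<in> V \<Longrightarrow> \<forall>q\<in>Q. f q = 0 \<Longrightarrow> f = 0"
    using span_finite_has_test_points[of B] by auto
  \<comment> \<open>Points outside \<open>X\<close> test nothing, as the members of \<open>V\<close> vanish there.\<close>
  have "\<forall>q\<in>Q. f q = 0" if "f \<in> V" "\<forall>q\<in>Q \<inter> X. f q = 0" for f
    using that V by (auto simp: functions_on_def)
  then have "correct_test_sequence X V (Q \<inter> X)"
    using Q by (simp add: correct_test_sequence_def)
  then show ?thesis ..
qed

text \<open>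
  The members of \<open>V\<close> vanishing at one test point \<open>q\<close> form a subspace tested by the remaining points,
  and \<open>V\<close> is spanned by this subspace together with any one \<open>h\<close> for which \<open>h q \<noteq> 0\<close>.
\<close>
lemma finite_dimensional_if_tested_finitely:
  fixes V :: "('x \<Rightarrow> 'k::field) set"
  assumes "finite Q" and "fun_space.subspace V"
    and "\<And>f. f \<in> V \<Longrightarrow> \<forall>q\<in>Q. f q = 0 \<Longrightarrow> f = 0"
  shows "finite_dimensional V"
  using assms
proof (induction Q arbitrary: V)
  case empty
  then have "V = {0}"
    using fun_space.subspace_0 by blast
  then show ?case
    by (auto simp: finite_dimensional_def intro: exI[of _ "{}"])
next
  case (insert q Q)
  note V = insert.prems(1)
  let ?W = "{f\<in>V. f q = 0}"
  have "fun_space.subspace ?W"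
    using fun_space.subspace_0[OF V] fun_space.subspace_add[OF V] fun_space.subspace_scale[OF V]
    by (intro fun_space.subspaceI) (auto simp: fscale_def)
  then have "finite_dimensional ?W"
    using insert.prems(2) by (intro insert.IH) auto
  then obtain B where B: "finite B" "B \<subseteq> ?W" "fun_space.span B = ?W"
    by (auto simp: finite_dimensional_def)
  show ?case
  proof (cases "\<exists>h\<in>V. h q \<noteq> 0")
    case False
    then have "?W = V" by auto
    then show ?thesis using \<open>finite_dimensional ?W\<close> by simp
  next
    case True
    then obtain h where h: "h \<in> V" "h q \<noteq> 0" by blast
    have "f \<in> fun_space.span (insert h B)" if f: "f \<in> V" for f
    proof -
      have "f - fscale (f q / h q) h \<in> V"
        by (intro fun_space.subspace_diff[OF V] fun_space.subspace_scale[OF V] f h)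
      then have "f - fscale (f q / h q) h \<in> fun_space.span B"
        using h by (simp add: B fscale_def)
      then show ?thesis by (auto simp: fun_space.span_breakdown_eq)
    qed
    moreover have "fun_space.span (insert h B) \<subseteq> V"
      using B(2) h V by (intro fun_space.span_minimal) auto
    ultimately show ?thesis
      unfolding finite_dimensional_def using B(1,2) h
      by (intro exI[of _ "insert h B"]) auto
  qed
qed

section \<open>Equivalence of the conditions\<close>

theorem proposition4p4:
  fixes av :: "'k::field \<Rightarrow> real"
    and X :: "'x set"
    and F \<Omega> :: "('x \<Rightarrow> 'k) set"
    and L :: nat
    and x :: "nat \<Rightarrow> 'x"
    and Q :: "'x set"
  assumes "absolute_value av"
    and "F \<subseteq> functions_on X"
    and "Modules.module.subspace fscale F"
    and "subgroup \<Omega> (additive_group F)"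
    and "Q = x ` {1..L}"
    and "Q \<subseteq> X"
  shows
    "(correct_test_sequence X \<Omega> Q \<longleftrightarrow> finite_norming_set av X \<Omega> Q) \<and>
     (correct_test_sequence X \<Omega> Q \<longleftrightarrow>
        ev L x \<in> mon (additive_group \<Omega>)
          (product_group {1..L} (\<lambda>_. additive_group (UNIV :: 'k set)))) \<and>
     (correct_test_sequence X \<Omega> Q \<longleftrightarrow>
        (\<exists>p::ereal. 1 \<le> p \<and> norm_on_subset av \<Omega> (p_norm av L x p))) \<and>
     (correct_test_sequence X \<Omega> Q \<longleftrightarrow>
        (\<forall>p::ereal. 1 \<le> p \<longrightarrow> norm_on_subset av \<Omega> (p_norm av L x p))) \<and>
     (correct_test_sequence X \<Omega> Q \<longleftrightarrow>
        Metric_space \<Omega> (\<lambda>f g. sup_norm av Q (f - g))) \<and>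
     (correct_test_sequence X \<Omega> Q \<longleftrightarrow>
        (\<forall>p::ereal. 1 \<le> p \<longrightarrow> Metric_space \<Omega> (\<lambda>f g. p_norm av L x p (f - g)))) \<and>
     ((\<exists>Q'. correct_test_sequence X \<Omega> Q') \<longleftrightarrow> (\<exists>Q'. finite_norming_set av X \<Omega> Q')) \<and>
     (Modules.module.subspace fscale \<Omega> \<longrightarrow>
        ((\<exists>Q'. correct_test_sequence X \<Omega> Q') \<longleftrightarrow>
         (\<exists>N. normed_linear_space av \<Omega> N) \<and> finite_dimensional \<Omega>))"
proof -
  let ?ct = "correct_test_sequence X \<Omega>"
  note av = assms(1)
  have Q: "finite Q" "Q \<subseteq> X" using assms by auto
  note closed = subgroup_additive_group_closed[OF assms(3,4)]
  have \<Omega>: "\<Omega> \<subseteq> functions_on X"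
    using subgroup.subset[OF assms(4)] assms(2) by (auto simp: additive_group_def)
  have norming: "?ct Q' \<longleftrightarrow> finite_norming_set av X \<Omega> Q'" for Q'
  proof (cases "finite Q' \<and> Q' \<subseteq> X")
    case True
    then interpret evaluation_seminorm av Q' "sup_norm av Q'"
      using evaluation_seminorm_sup_norm[OF av] by blast
    show ?thesis
      using correct_test_sequence_iff_norm_on_subset[of X \<Omega>] True
      by (simp add: finite_norming_set_def)
  next
    case False
    then show ?thesis
      by (auto simp: finite_norming_set_def correct_test_sequence_def)
  qed
  have mon: "?ct Q \<longleftrightarrow> ev L x \<in> mon (additive_group \<Omega>)
      (product_group {1..L} (\<lambda>_. additive_group (UNIV :: 'k set)))"
    using correct_test_sequence_iff_ev_mon[OF closed] assms(5,6) by simp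
  have p_norm: "evaluation_seminorm av Q (p_norm av L x p)" if "1 \<le> p" for p
    using evaluation_seminorm_p_norm[OF av that] assms(5) by simp
  have norm_p: "?ct Q \<longleftrightarrow> norm_on_subset av \<Omega> (p_norm av L x p)" if "1 \<le> p" for p
    using evaluation_seminorm.correct_test_sequence_iff_norm_on_subset[OF p_norm[OF that] Q] .
  have metric_p: "?ct Q \<longleftrightarrow> Metric_space \<Omega> (\<lambda>f g. p_norm av L x p (f - g))" if "1 \<le> p" for p
    using evaluation_seminorm.correct_test_sequence_iff_Metric_space[OF p_norm[OF that] Q closed] .
  have metric: "?ct Q \<longleftrightarrow> Metric_space \<Omega> (\<lambda>f g. sup_norm av Q (f - g))"
    using evaluation_seminorm.correct_test_sequence_iff_Metric_space[
        OF evaluation_seminorm_sup_norm[OF av Q(1)] Q closed] .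
  have linear: "(\<exists>Q'. ?ct Q') \<longleftrightarrow> (\<exists>N. normed_linear_space av \<Omega> N) \<and> finite_dimensional \<Omega>"
    if sub: "Modules.module.subspace fscale \<Omega>"
  proof
    assume "\<exists>Q'. ?ct Q'"
    then obtain Q' where Q': "?ct Q'" ..
    then have "finite Q'" by (simp add: correct_test_sequence_def)
    then have "normed_linear_space av \<Omega> (sup_norm av Q')"
      by (intro evaluation_seminorm.normed_linear_space_if_correct_test_sequence[OF _ sub Q']
          evaluation_seminorm_sup_norm[OF av])
    moreover have "finite_dimensional \<Omega>"
      using Q' by (intro finite_dimensional_if_tested_finitely[OF \<open>finite Q'\<close> sub])
        (auto simp: correct_test_sequence_def)
    ultimately show "(\<exists>N. normed_linear_space av \<Omega> N) \<and> finite_dimensional \<Omega>" by blast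
  next
    assume "(\<exists>N. normed_linear_space av \<Omega> N) \<and> finite_dimensional \<Omega>"
    then show "\<exists>Q'. ?ct Q'"
      using finite_dimensional_imp_correct_test_sequence[OF _ \<Omega>] by blast
  qed
  have one: "(1::ereal) \<le> 1" by simp
  have ex_p: "?ct Q \<longleftrightarrow> (\<exists>p::ereal. 1 \<le> p \<and> norm_on_subset av \<Omega> (p_norm av L x p))"
    and all_p: "?ct Q \<longleftrightarrow> (\<forall>p::ereal. 1 \<le> p \<longrightarrow> norm_on_subset av \<Omega> (p_norm av L x p))"
    and all_metric: "?ct Q \<longleftrightarrow>
      (\<forall>p::ereal. 1 \<le> p \<longrightarrow> Metric_space \<Omega> (\<lambda>f g. p_norm av L x p (f - g)))"
    using norm_p metric_p one by blast+
  show ?thesis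
    using norming mon ex_p all_p metric all_metric linear by blast
qed

end
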